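(* Let $c>0$ and $0<\kappa<c/2$ be fixed. Then there exists a smooth solitary wave solution of $$u_t-u_{txx}+2uu_x=u_xu_{xx}+uu_{xxx}$$ of the form $u(x,t)=\phi(\xi)$, $\xi=x-ct$, with wave shape $\phi=\phi(\cdot;c,\kappa)\in C^\infty(\mathbb R)$ such that $\phi(\xi;c,\kappa)\to\kappa$ exponentially as $\xi\to\pm\infty$ and $\partial_\xi\phi(0;c,\kappa)=0$ up to spatial translations. In addition, $\kappa<\phi(\xi;c,\kappa)<c$ for all $\xi\in\mathbb R$.
   Context: The equation is the $b$-family of Camassa-Holm equations $u_t-u_{txx}+(b+1)uu_x=bu_xu_{xx}+uu_{xxx}$ with $b=1$. "Up to spatial translations" means that the condition $\partial_\xi\phi(0)=0$ is obtained after replacing $\phi$ by a suitable translate $\phi(\cdot+s)$. *)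

theory Defs
  imports "HOL-Analysis.Analysis" "HOL-Library.Landau_Symbols"
begin

definition smooth :: "(real \<Rightarrow> real) \<Rightarrow> bool" where
  "smooth f \<longleftrightarrow> (\<forall>n. (deriv ^^ n) f differentiable_on UNIV)"

definition D_x :: "(real \<Rightarrow> real \<Rightarrow> real) \<Rightarrow> real \<Rightarrow> real \<Rightarrow> real" where
  "D_x u = (\<lambda>x t. deriv (\<lambda>y. u y t) x)"

definition D_t :: "(real \<Rightarrow> real \<Rightarrow> real) \<Rightarrow> real \<Rightarrow> real \<Rightarrow> real" where
  "D_t u = (\<lambda>x t. deriv (\<lambda>s. u x s) t)"

definition has_D_x :: "(real \<Rightarrow> real \<Rightarrow> real) \<Rightarrow> bool" where
  "has_D_x u \<longleftrightarrow> (\<forall>x t. (\<lambda>y. u y t) differentiable (at x))"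

definition has_D_t :: "(real \<Rightarrow> real \<Rightarrow> real) \<Rightarrow> bool" where
  "has_D_t u \<longleftrightarrow> (\<forall>x t. (\<lambda>s. u x s) differentiable (at t))"

text \<open>
  Classical solutions \<open>u x t\<close> of the member \<open>b = 1\<close> of the \<open>b\<close>-family of Camassa--Holm
  equations, \<open>u\<^sub>t - u\<^sub>t\<^sub>x\<^sub>x + 2 u u\<^sub>x = u\<^sub>x u\<^sub>x\<^sub>x + u u\<^sub>x\<^sub>x\<^sub>x\<close>. Since \<^const>\<open>deriv\<close> is total, the
  existence of every partial derivative that occurs is required explicitly.
\<close>
definition CH_b1_solution :: "(real \<Rightarrow> real \<Rightarrow> real) \<Rightarrow> bool" where
  "CH_b1_solution u \<longleftrightarrow>
     has_D_t u \<and> has_D_x (D_t u) \<and> has_D_x (D_x (D_t u)) \<and>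
     has_D_x u \<and> has_D_x (D_x u) \<and> has_D_x (D_x (D_x u)) \<and>
     (\<forall>x t. D_t u x t - D_x (D_x (D_t u)) x t + 2 * u x t * D_x u x t
            = D_x u x t * D_x (D_x u) x t + u x t * D_x (D_x (D_x u)) x t)"

text \<open>
  On the reals, \<^const>\<open>at_infinity\<close> covers both ends \<open>\<xi> \<rightarrow> \<infinity>\<close> and \<open>\<xi> \<rightarrow> -\<infinity>\<close>.
\<close>
definition tends_exponentially_at_infinity :: "(real \<Rightarrow> real) \<Rightarrow> real \<Rightarrow> bool" where
  "tends_exponentially_at_infinity f l \<longleftrightarrow>
     (\<exists>\<alpha>>0. (\<lambda>\<xi>. f \<xi> - l) \<in> O[at_infinity](\<lambda>\<xi>. exp (- \<alpha> * \<bar>\<xi>\<bar>)))"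

end

theory Submission
  imports Defs
begin

text \<open>
  For \<open>u (x, t) = \<phi> (x - c t)\<close> both sides of the equation are derivatives in \<open>\<xi> = x - c t\<close>, because
  \<open>\<phi>' \<phi>'' + \<phi> \<phi>''' = (\<phi> \<phi>'')'\<close>. Integrating once, with the constant dictated by the limit \<open>\<kappa>\<close>, gives
  \<open>\<phi>'' = f (\<phi>)\<close> with \<open>f y = y - K / (c - y)\<close> and \<open>K = \<kappa> (c - \<kappa>)\<close>. Integrating a second time gives
  \<open>\<phi>'\<^sup>2 = F (\<phi>)\<close> with \<open>F y = y\<^sup>2 - \<kappa>\<^sup>2 + 2 K ln ((c - y) / (c - \<kappa>))\<close>, and \<open>F' = 2 f\<close>.

  Since \<open>f y = (y - \<kappa>) (c - \<kappa> - y) / (c - y)\<close> and \<open>\<kappa> < c - \<kappa>\<close>, the function \<open>F\<close> has a double zero at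
  \<open>\<kappa>\<close>, increases up to \<open>c - \<kappa>\<close> and then decreases to \<open>-\<infinity>\<close> at \<open>c\<close>. It therefore has exactly one
  further zero \<open>M\<close>, which lies strictly between \<open>c - \<kappa>\<close> and \<open>c\<close> and is simple. The solitary wave is the
  orbit homoclinic to the saddle \<open>\<kappa>\<close> which turns round at the crest \<open>M < c\<close>; placing the crest at
  \<open>\<xi> = 0\<close> fixes the translate.

  The lemma \<open>homoclinic_orbit\<close> constructs such orbits for general \<open>F\<close>. It reduces the second-order
  equation to a regular scalar one, which \<open>autonomous_ode_global_solution\<close> solves by separation of
  variables. Near \<open>\<kappa>\<close> the function \<open>F\<close> is at least \<open>\<alpha>\<^sup>2 (y - \<kappa>)\<^sup>2\<close> with \<open>\<alpha> > 0\<close>, so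
  \<open>\<bar>\<phi>'\<bar> \<ge> \<alpha> (\<phi> - \<kappa>)\<close> in both tails, and
  \<open>two_sided_differential_inequality_imp_exponential_limit\<close> gives exponential decay. Smoothness is a
  bootstrap: as \<open>\<phi>\<close> stays below \<open>c\<close>, all derivatives are polynomials in \<open>\<phi>\<close>, \<open>\<phi>'\<close> and
  \<open>1 / (c - \<phi>)\<close>.
\<close>

section \<open>Autonomous scalar equations\<close>

text \<open>
  Separation of variables: a solution is the inverse function of an antiderivative \<open>X\<close> of
  \<open>1 / H\<close>. The Lyapunov function \<open>V\<close> rules out blow-up in finite time: it grows along the flow
  with speed at most \<open>1\<close>, so reaching an end of the interval, where \<open>V\<close> is infinite, takes
  infinitely long. In terms of \<open>X\<close>, both \<open>X - V\<close> and \<open>X + V\<close> increase, hence \<open>X\<close> maps the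
  interval onto the whole line.
\<close>
lemma autonomous_ode_global_solution:
  fixes a b s0 :: real and H V V' :: "real \<Rightarrow> real"
  assumes s0: "a < s0" "s0 < b"
    and cont: "continuous_on {a<..<b} H"
    and pos: "\<And>s. a < s \<Longrightarrow> s < b \<Longrightarrow> H s > 0"
    and derV: "\<And>s. a < s \<Longrightarrow> s < b \<Longrightarrow> (V has_real_derivative V' s) (at s)"
    and speed: "\<And>s. a < s \<Longrightarrow> s < b \<Longrightarrow> \<bar>V' s\<bar> * H s \<le> 1"
    and topL: "filterlim V at_top (at_right a)" and topR: "filterlim V at_top (at_left b)"
  obtains \<sigma> where "\<sigma> 0 = s0" "strict_mono \<sigma>" "range \<sigma> = {a<..<b}"
    "\<And>\<xi>. (\<sigma> has_real_derivative H (\<sigma> \<xi>)) (at \<xi>)"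
proof -
  have "\<exists>Y. \<forall>s::real. ereal a < s \<longrightarrow> s < ereal b \<longrightarrow> (Y has_vector_derivative 1 / H s) (at s)"
  proof (rule einterval_antiderivative)
    show "ereal a < ereal b" using s0 by simp
    fix s :: real assume "ereal a < ereal s" "ereal s < ereal b"
    hence s: "s \<in> {a<..<b}" by simp
    have "isCont H s" using cont s by (metis continuous_on_eq_continuous_at open_greaterThanLessThan)
    moreover have "H s \<noteq> 0" using pos[of s] s by auto
    ultimately show "isCont (\<lambda>s. 1 / H s) s" by (intro continuous_intros)
  qed
  then obtain Y where Y: "\<And>s. a < s \<Longrightarrow> s < b \<Longrightarrow> (Y has_real_derivative 1 / H s) (at s)"
    by (auto simp: has_real_derivative_iff_has_vector_derivative)
  define X where "X s = Y s - Y s0" for s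
  have derX: "(X has_real_derivative 1 / H s) (at s)" if "a < s" "s < b" for s
    unfolding X_def using Y[OF that] by (auto intro!: derivative_eq_intros)
  have X0: "X s0 = 0" by (simp add: X_def)
  have incX: "X s < X t" if "a < s" "s < t" "t < b" for s t
  proof (rule DERIV_pos_imp_increasing[OF that(2)])
    fix x assume "s \<le> x" "x \<le> t"
    thus "\<exists>y. (X has_real_derivative y) (at x) \<and> 0 < y"
      using that derX[of x] pos[of x] by (intro exI[of _ "1 / H x"]) auto
  qed
  have bounds: "\<bar>V' x\<bar> \<le> 1 / H x" if "a < x" "x < b" for x
    using speed[OF that] pos[OF that] by (simp add: field_simps)
  have VX: "V t - V s \<le> X t - X s \<and> V s - V t \<le> X t - X s" if "a < s" "s \<le> t" "t < b" for s t
  proof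
    have "X s - V s \<le> X t - V t"
    proof (rule DERIV_nonneg_imp_nondecreasing[OF that(2)])
      fix x assume "s \<le> x" "x \<le> t"
      hence x: "a < x" "x < b" using that by auto
      show "\<exists>y. ((\<lambda>s. X s - V s) has_real_derivative y) (at x) \<and> 0 \<le> y"
        using DERIV_diff[OF derX[OF x] derV[OF x]] bounds[OF x] by (intro exI conjI) auto
    qed
    thus "V t - V s \<le> X t - X s" by simp
    have "X s + V s \<le> X t + V t"
    proof (rule DERIV_nonneg_imp_nondecreasing[OF that(2)])
      fix x assume "s \<le> x" "x \<le> t"
      hence x: "a < x" "x < b" using that by auto
      show "\<exists>y. ((\<lambda>s. X s + V s) has_real_derivative y) (at x) \<and> 0 \<le> y"
        using DERIV_add[OF derX[OF x] derV[OF x]] bounds[OF x] by (intro exI conjI) auto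
    qed
    thus "V s - V t \<le> X t - X s" by simp
  qed
  have onto: "\<exists>s. a < s \<and> s < b \<and> X s = \<xi>" for \<xi>
  proof -
    have "\<forall>\<^sub>F s in at_left b. V s \<ge> V s0 + \<bar>\<xi>\<bar>" using topR by (simp add: filterlim_at_top)
    moreover have "\<forall>\<^sub>F s in at_left b. s \<in> {s0<..<b}" by (rule eventually_at_left_real[OF s0(2)])
    ultimately have "\<forall>\<^sub>F s in at_left b. V s \<ge> V s0 + \<bar>\<xi>\<bar> \<and> s \<in> {s0<..<b}"
      by (rule eventually_conj)
    then obtain s2 where s2: "V s2 \<ge> V s0 + \<bar>\<xi>\<bar>" "s0 < s2" "s2 < b"
      using eventually_happens[of _ "at_left b"] trivial_limit_at_left_real by fastforce
    have "\<forall>\<^sub>F s in at_right a. V s \<ge> V s0 + \<bar>\<xi>\<bar>" using topL by (simp add: filterlim_at_top)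
    moreover have "\<forall>\<^sub>F s in at_right a. s \<in> {a<..<s0}" by (rule eventually_at_right_real[OF s0(1)])
    ultimately have "\<forall>\<^sub>F s in at_right a. V s \<ge> V s0 + \<bar>\<xi>\<bar> \<and> s \<in> {a<..<s0}"
      by (rule eventually_conj)
    then obtain s1 where s1: "V s1 \<ge> V s0 + \<bar>\<xi>\<bar>" "a < s1" "s1 < s0"
      using eventually_happens[of _ "at_right a"] trivial_limit_at_right_real by fastforce
    have "X s1 \<le> \<xi>" "\<xi> \<le> X s2"
      using VX[of s1 s0] VX[of s0 s2] s0 s1 s2 X0 by auto
    moreover have "continuous_on {s1..s2} X"
    proof (rule DERIV_atLeastAtMost_imp_continuous_on)
      fix x assume "s1 \<le> x" "x \<le> s2"
      thus "\<exists>y. (X has_real_derivative y) (at x)"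
        using derX[of x] s1 s2 by (intro exI[of _ "1 / H x"]) auto
    qed
    ultimately obtain s where "s1 \<le> s" "s \<le> s2" "X s = \<xi>"
      using IVT'[of X s1 \<xi> s2] s1 s2 by auto
    thus ?thesis using s1 s2 by (intro exI[of _ s]) auto
  qed
  then obtain \<sigma> where \<sigma>: "\<And>\<xi>. a < \<sigma> \<xi>" "\<And>\<xi>. \<sigma> \<xi> < b" "\<And>\<xi>. X (\<sigma> \<xi>) = \<xi>" by metis
  have left_inv: "\<sigma> (X s) = s" if "a < s" "s < b" for s
    using incX[of s "\<sigma> (X s)"] incX[of "\<sigma> (X s)" s] \<sigma>[of "X s"] that
    by (cases "\<sigma> (X s)" s rule: linorder_cases) auto
  have mono: "strict_mono \<sigma>"
  proof (rule strict_monoI)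
    fix \<xi> \<eta> :: real assume "\<xi> < \<eta>"
    thus "\<sigma> \<xi> < \<sigma> \<eta>"
      using incX[of "\<sigma> \<eta>" "\<sigma> \<xi>"] \<sigma>[of \<xi>] \<sigma>[of \<eta>]
      by (cases "\<sigma> \<xi>" "\<sigma> \<eta>" rule: linorder_cases) auto
  qed
  have ran: "range \<sigma> = {a<..<b}"
  proof
    show "range \<sigma> \<subseteq> {a<..<b}" using \<sigma> by auto
    show "{a<..<b} \<subseteq> range \<sigma>" using left_inv by (metis greaterThanLessThan_iff rangeI subsetI)
  qed
  have contS: "continuous_on UNIV \<sigma>"
    by (rule continuous_onI_mono) (use ran mono in \<open>auto simp: strict_mono_less_eq\<close>)
  show thesis
  proof (rule that)
    show "\<sigma> 0 = s0" using left_inv[OF s0] X0 by simp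
    show "strict_mono \<sigma>" "range \<sigma> = {a<..<b}" by fact+
    show "(\<sigma> has_real_derivative H (\<sigma> \<xi>)) (at \<xi>)" for \<xi>
    proof -
      have "(\<sigma> has_real_derivative inverse (1 / H (\<sigma> \<xi>))) (at \<xi>)"
        by (rule DERIV_inverse_function[of X _ _ _ "\<xi> - 1" "\<xi> + 1"])
          (use \<sigma> derX pos[of "\<sigma> \<xi>"] contS in \<open>auto simp: continuous_on_eq_continuous_at\<close>)
      thus ?thesis by simp
    qed
  qed
qed

section \<open>Homoclinic orbits of a conservative system\<close>

text \<open>
  Both \<open>g\<close> and an antiderivative of \<open>g'\<close> are continuous, and they differ by a constant on each side
  of \<open>p\<close>.
\<close>
lemma has_real_derivative_removable_point:
  fixes g g' :: "real \<Rightarrow> real"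
  assumes contg: "continuous_on UNIV g" and contg': "continuous_on UNIV g'"
    and der: "\<And>x. x \<noteq> p \<Longrightarrow> (g has_real_derivative g' x) (at x)"
  shows "(g has_real_derivative g' x) (at x)"
proof -
  have "\<exists>G. \<forall>x::real. -\<infinity> < ereal x \<longrightarrow> ereal x < \<infinity> \<longrightarrow> (G has_vector_derivative g' x) (at x)"
    by (rule einterval_antiderivative)
      (use contg' in \<open>auto simp: continuous_on_eq_continuous_at\<close>)
  then obtain G where G: "\<And>x. (G has_real_derivative g' x) (at x)"
    by (auto simp: has_real_derivative_iff_has_vector_derivative)
  have cont: "continuous_on S (\<lambda>x. g x - G x)" for S
    using contg DERIV_isCont[OF G]
    by (intro continuous_intros) (auto intro: continuous_on_subset continuous_at_imp_continuous_on)
  have zero: "((\<lambda>x. g x - G x) has_real_derivative 0) (at x)" if "x \<noteq> p" for x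
    using DERIV_diff[OF der[OF that] G[of x]] by simp
  have const: "g x - G x = g p - G p" for x
  proof (cases x p rule: linorder_cases)
    case less
    have "g p - G p = g x - G x"
      by (rule DERIV_isconst_end[OF less cont]) (use zero in auto)
    thus ?thesis by simp
  next
    case greater
    show ?thesis
      by (rule DERIV_isconst_end[OF greater cont]) (use zero in auto)
  qed auto
  have "g = (\<lambda>x. G x + (g p - G p))" using const by (auto simp: algebra_simps)
  moreover have "((\<lambda>x. G x + (g p - G p)) has_real_derivative g' x) (at x)"
    using G[of x] by (auto intro!: derivative_eq_intros)
  ultimately show ?thesis by simp
qed

text \<open>
  The second-order equation \<open>\<phi>'' = f (\<phi>)\<close> has the first integral \<open>\<phi>'\<^sup>2 - F (\<phi>)\<close>, so the wanted
  orbit satisfies \<open>\<phi>' = \<plusminus> sqrt (F (\<phi>))\<close>. This first-order equation is degenerate at the simple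
  zero \<open>M\<close> of \<open>F\<close>, where the orbit turns round. The substitution \<open>\<phi> = M - s\<^sup>2\<close> removes the
  degeneracy: it gives \<open>s' = sqrt (F (M - s\<^sup>2) / s\<^sup>2) / 2\<close>, whose right-hand side extends to a
  positive continuous function through \<open>s = 0\<close>, since \<open>F\<close> has negative slope at \<open>M\<close>. The upper bound on
  \<open>F\<close> means \<open>\<bar>\<phi>'\<bar> \<le> C (\<phi> - k)\<close>; hence \<open>- ln (\<phi> - k) / C\<close> grows with speed at most \<open>1\<close>, and \<open>k\<close> is
  not reached in finite time.
\<close>
lemma homoclinic_orbit:
  fixes F f :: "real \<Rightarrow> real" and k M C :: real
  assumes kM: "k < M" and C: "C > 0"
    and derF: "\<And>y. k < y \<Longrightarrow> y \<le> M \<Longrightarrow> (F has_real_derivative 2 * f y) (at y)"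
    and contf: "continuous_on {k<..M} f"
    and posF: "\<And>y. k < y \<Longrightarrow> y < M \<Longrightarrow> F y > 0"
    and FM: "F M = 0" and fM: "f M < 0"
    and bound: "\<And>y. k < y \<Longrightarrow> y \<le> M \<Longrightarrow> F y \<le> (C * (y - k))\<^sup>2"
  obtains \<phi> \<psi> where
    "\<And>\<xi>. (\<phi> has_real_derivative \<psi> \<xi>) (at \<xi>)"
    "\<And>\<xi>. (\<psi> has_real_derivative f (\<phi> \<xi>)) (at \<xi>)"
    "\<And>\<xi>. k < \<phi> \<xi>" "\<And>\<xi>. \<phi> \<xi> \<le> M"
    "\<And>\<xi>. \<psi> \<xi> = - sgn \<xi> * sqrt (F (\<phi> \<xi>))"
    "(\<phi> \<longlongrightarrow> k) at_infinity"
proof -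
  define S where "S = sqrt (M - k)"
  have S: "S > 0" "S\<^sup>2 = M - k" using kM by (auto simp: S_def)
  have range_s: "k < M - s\<^sup>2" if "-S < s" "s < S" for s
    using S that abs_square_less_1[of "s / S"] power2_strict_mono[of s S] by auto
  \<comment> \<open>The value at \<open>M\<close> is the limit of the quotient, because \<open>F' = 2 f\<close>.\<close>
  define h where "h y = (if y = M then - 2 * f M else F y / (M - y))" for y
  have hpos: "h y > 0" if "k < y" "y \<le> M" for y
    using that posF[of y] fM by (auto simp: h_def)
  have s2h: "s\<^sup>2 * h (M - s\<^sup>2) = F (M - s\<^sup>2)" for s
    by (auto simp: h_def FM)
  have conth: "continuous_on {k<..M} h"
  proof (unfold continuous_on_eq_continuous_within, intro ballI)
    fix y assume y: "y \<in> {k<..M}"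
    show "continuous (at y within {k<..M}) h"
    proof (cases "y = M")
      case False
      have "isCont F y" using derF[of y] y by (intro DERIV_isCont) auto
      hence "isCont (\<lambda>z. F z / (M - z)) y" using False by (intro continuous_intros) auto
      moreover have "\<forall>\<^sub>F z in nhds y. h z = F z / (M - z)"
        using t1_space_nhds[OF False] by eventually_elim (auto simp: h_def)
      ultimately have "isCont h y" using isCont_cong[of h "\<lambda>z. F z / (M - z)" y] by blast
      thus ?thesis by (rule continuous_at_imp_continuous_at_within)
    next
      case True
      have "((\<lambda>z. (F z - F M) / (z - M)) \<longlongrightarrow> 2 * f M) (at M)"
        using derF[of M] kM by (simp add: has_field_derivative_iff)
      hence "((\<lambda>z. - ((F z - F M) / (z - M))) \<longlongrightarrow> - (2 * f M)) (at M)"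
        by (rule tendsto_minus)
      moreover have "\<forall>\<^sub>F z in at M. - ((F z - F M) / (z - M)) = h z"
        by (auto simp: eventually_at_filter h_def FM minus_divide_right)
      ultimately have "(h \<longlongrightarrow> - (2 * f M)) (at M)"
        by (rule Lim_transform_eventually)
      hence "isCont h M" by (simp add: isCont_def h_def)
      thus ?thesis using True by (auto intro: continuous_at_imp_continuous_at_within)
    qed
  qed
  define H where "H s = sqrt (h (M - s\<^sup>2)) / 2" for s
  define V where "V s = - ln (S\<^sup>2 - s\<^sup>2) / C" for s
  have gap: "S\<^sup>2 - s\<^sup>2 > 0" if "-S < s" "s < S" for s
    using range_s[OF that] S by simp
  obtain \<sigma> where \<sigma>0: "\<sigma> 0 = 0" and mono: "strict_mono \<sigma>" and ran: "range \<sigma> = {-S<..<S}"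
    and der\<sigma>: "\<And>\<xi>. (\<sigma> has_real_derivative H (\<sigma> \<xi>)) (at \<xi>)"
  proof (rule autonomous_ode_global_solution[of "-S" 0 S H V "\<lambda>s. 2 * s / (C * (S\<^sup>2 - s\<^sup>2))"])
    show "-S < 0" "0 < S" using S by auto
    show "continuous_on {-S<..<S} H"
      unfolding H_def using range_s
      by (intro continuous_intros continuous_on_compose2[OF conth]) auto
    show "H s > 0" if "-S < s" "s < S" for s
      using hpos range_s[OF that] by (simp add: H_def)
    show "(V has_real_derivative 2 * s / (C * (S\<^sup>2 - s\<^sup>2))) (at s)" if "-S < s" "s < S" for s
      unfolding V_def using gap[OF that] C
      by (auto intro!: derivative_eq_intros simp: field_simps)
    show "\<bar>2 * s / (C * (S\<^sup>2 - s\<^sup>2))\<bar> * H s \<le> 1" if s: "-S < s" "s < S" for s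
    proof -
      let ?y = "M - s\<^sup>2"
      have y: "?y - k = S\<^sup>2 - s\<^sup>2" using S by simp
      have "\<bar>s\<bar> * sqrt (h ?y) = sqrt (F ?y)"
        by (simp add: s2h[symmetric] real_sqrt_mult)
      also have "\<dots> \<le> sqrt ((C * (?y - k))\<^sup>2)"
        using bound[of ?y] range_s[OF s] by (intro real_sqrt_le_mono) auto
      also have "\<dots> = C * (S\<^sup>2 - s\<^sup>2)" using gap[OF s] C by (simp add: y)
      finally have "\<bar>s\<bar> * sqrt (h ?y) \<le> C * (S\<^sup>2 - s\<^sup>2)" .
      moreover have "C * (S\<^sup>2 - s\<^sup>2) > 0" using gap[OF s] C by simp
      ultimately show ?thesis using gap[OF s] C
        by (simp add: H_def abs_mult abs_divide field_simps)
    qed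
    have lim: "filterlim V at_top (at x within A)"
      if A: "x\<^sup>2 = S\<^sup>2" "\<forall>\<^sub>F s in at x within A. -S < s \<and> s < S" for x A
    proof -
      have "((\<lambda>s. S\<^sup>2 - s\<^sup>2) \<longlongrightarrow> S\<^sup>2 - x\<^sup>2) (at x within A)" by (intro tendsto_intros)
      moreover have "\<forall>\<^sub>F s in at x within A. S\<^sup>2 - s\<^sup>2 \<in> {0<..}"
        using A(2) by eventually_elim (auto dest: gap)
      ultimately have "filterlim (\<lambda>s. S\<^sup>2 - s\<^sup>2) (at_right 0) (at x within A)"
        using A(1) by (auto simp: filterlim_at elim: eventually_mono)
      hence "filterlim (\<lambda>s. ln (S\<^sup>2 - s\<^sup>2)) at_bot (at x within A)"
        by (rule filterlim_compose[OF ln_at_0])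
      hence "filterlim (\<lambda>s. - ln (S\<^sup>2 - s\<^sup>2)) at_top (at x within A)"
        by (simp add: filterlim_uminus_at_bot)
      hence "filterlim (\<lambda>s. (1 / C) * (- ln (S\<^sup>2 - s\<^sup>2))) at_top (at x within A)"
        by (intro filterlim_tendsto_pos_mult_at_top[OF tendsto_const]) (use C in auto)
      thus ?thesis by (simp add: V_def[abs_def])
    qed
    show "filterlim V at_top (at_right (-S))"
      using eventually_at_right_real[of "-S" S] S by (intro lim) auto
    show "filterlim V at_top (at_left S)"
      using eventually_at_left_real[of "-S" S] S by (intro lim) auto
  qed blast
  have \<sigma>S: "-S < \<sigma> \<xi>" "\<sigma> \<xi> < S" for \<xi> using ran by auto
  have sgn\<sigma>: "sgn (\<sigma> \<xi>) = sgn \<xi>" for \<xi>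
    using strict_mono_less[OF mono, of 0 \<xi>] strict_mono_less[OF mono, of \<xi> 0] \<sigma>0
    by (auto simp: sgn_if)
  have cont\<sigma>: "continuous_on UNIV \<sigma>"
    using DERIV_isCont[OF der\<sigma>] by (simp add: continuous_at_imp_continuous_on)
  define \<phi> where "\<phi> \<xi> = M - (\<sigma> \<xi>)\<^sup>2" for \<xi>
  define \<psi> where "\<psi> \<xi> = - \<sigma> \<xi> * sqrt (h (\<phi> \<xi>))" for \<xi>
  have \<phi>: "k < \<phi> \<xi>" "\<phi> \<xi> \<le> M" for \<xi>
    using range_s[OF \<sigma>S] by (auto simp: \<phi>_def)
  have der\<phi>: "(\<phi> has_real_derivative \<psi> \<xi>) (at \<xi>)" for \<xi>
    unfolding \<phi>_def \<psi>_def
    by (rule derivative_eq_intros der\<sigma> refl)+ (simp add: H_def \<phi>_def)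
  have \<psi>: "\<psi> \<xi> = - sgn \<xi> * sqrt (F (\<phi> \<xi>))" for \<xi>
  proof -
    have "sqrt (F (\<phi> \<xi>)) = \<bar>\<sigma> \<xi>\<bar> * sqrt (h (\<phi> \<xi>))"
      by (simp add: \<phi>_def s2h[symmetric] real_sqrt_mult)
    moreover have "sgn \<xi> * \<bar>\<sigma> \<xi>\<bar> = \<sigma> \<xi>" by (metis sgn\<sigma> sgn_mult_abs)
    ultimately show ?thesis by (simp add: \<psi>_def mult.assoc[symmetric])
  qed
  have cont\<phi>: "continuous_on UNIV \<phi>"
    unfolding \<phi>_def by (intro continuous_intros cont\<sigma>)
  \<comment> \<open>\<open>h\<close> need not be differentiable at \<open>M\<close>, so \<open>\<psi>\<close> is differentiated through the first integral, which is possible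
    away from the crest \<open>\<xi> = 0\<close>.\<close>
  have der\<psi>: "(\<psi> has_real_derivative f (\<phi> \<xi>)) (at \<xi>)" for \<xi>
  proof (rule has_real_derivative_removable_point[of \<psi> "\<lambda>\<xi>. f (\<phi> \<xi>)" 0])
    show "continuous_on UNIV \<psi>"
      unfolding \<psi>_def
      by (intro continuous_intros cont\<sigma> continuous_on_compose2[OF conth cont\<phi>]) (use \<phi> in auto)
    show "continuous_on UNIV (\<lambda>\<xi>. f (\<phi> \<xi>))"
      by (intro continuous_on_compose2[OF contf cont\<phi>]) (use \<phi> in auto)
    fix \<xi> :: real assume \<xi>: "\<xi> \<noteq> 0"
    have "\<sigma> \<xi> \<noteq> 0" using sgn\<sigma>[of \<xi>] \<xi> by (metis sgn_0_0)
    hence FP: "F (\<phi> \<xi>) > 0" using posF \<phi> by (simp add: \<phi>_def)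
    have "((\<lambda>\<eta>. F (\<phi> \<eta>)) has_real_derivative 2 * f (\<phi> \<xi>) * \<psi> \<xi>) (at \<xi>)"
      by (rule DERIV_chain2[of F _ \<phi>, OF derF der\<phi>]) (use \<phi> in auto)
    hence "((\<lambda>\<eta>. - sgn \<xi> * sqrt (F (\<phi> \<eta>))) has_real_derivative
        - sgn \<xi> * (inverse (sqrt (F (\<phi> \<xi>))) / 2 * (2 * f (\<phi> \<xi>) * \<psi> \<xi>))) (at \<xi>)"
      by (intro DERIV_cmult DERIV_chain2[of sqrt _ "\<lambda>\<eta>. F (\<phi> \<eta>)"] DERIV_real_sqrt[OF FP])
    moreover have "- sgn \<xi> * (inverse (sqrt (F (\<phi> \<xi>))) / 2 * (2 * f (\<phi> \<xi>) * \<psi> \<xi>)) = f (\<phi> \<xi>)"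
      using FP \<xi> by (auto simp: \<psi> sgn_if)
    moreover have "\<forall>\<^sub>F \<eta> in nhds \<xi>. \<psi> \<eta> = - sgn \<xi> * sqrt (F (\<phi> \<eta>))"
    proof (cases "\<xi> > 0")
      case True
      show ?thesis
        using eventually_nhds_in_open[of "{0<..}" \<xi>] True
        by (auto elim!: eventually_mono simp: \<psi>)
    next
      case False
      show ?thesis
        using eventually_nhds_in_open[of "{..<0}" \<xi>] False \<xi>
        by (auto elim!: eventually_mono simp: \<psi>)
    qed
    ultimately show "(\<psi> has_real_derivative f (\<phi> \<xi>)) (at \<xi>)"
      using DERIV_cong_ev[of \<xi> \<xi> \<psi> "\<lambda>\<eta>. - sgn \<xi> * sqrt (F (\<phi> \<eta>))"] by simp
  qed
  have "(\<phi> \<longlongrightarrow> k) at_infinity"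
  proof (rule order_tendstoI)
    show "\<forall>\<^sub>F \<xi> in at_infinity. a < \<phi> \<xi>" if "a < k" for a
      using \<phi>(1) that by (intro always_eventually) (meson less_trans)
    fix a assume a: "k < a"
    define t where "t = sqrt (M - min a M)"
    have t: "0 \<le> t" "t < S" "t\<^sup>2 = M - min a M"
      using a kM by (auto simp: t_def S_def)
    have "t \<in> range \<sigma>" "-t \<in> range \<sigma>" unfolding ran using t S by auto
    then obtain p q where pq: "\<sigma> p = t" "\<sigma> q = -t" by (auto simp: image_iff)
    have "\<phi> \<xi> < a" if "p < \<xi> \<or> \<xi> < q" for \<xi>
    proof -
      have "t < \<bar>\<sigma> \<xi>\<bar>"
        using that strict_monoD[OF mono, of p \<xi>] strict_monoD[OF mono, of \<xi> q] pq by auto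
      hence "t\<^sup>2 < (\<sigma> \<xi>)\<^sup>2" using t by (metis power2_abs power_strict_mono zero_less_numeral)
      thus ?thesis using t by (auto simp: \<phi>_def)
    qed
    thus "\<forall>\<^sub>F \<xi> in at_infinity. \<phi> \<xi> < a"
      unfolding at_infinity_eq_at_top_bot eventually_sup
      by (auto intro!: eventually_mono[OF eventually_gt_at_top[of p]]
          eventually_mono[OF eventually_gt_at_bot[of q]])
  qed
  thus thesis by (rule that[OF der\<phi> der\<psi> \<phi> \<psi>])
qed

section \<open>Exponential decay\<close>

text \<open>A differential inequality of Gronwall type: \<open>g (\<xi>) exp (\<alpha> \<xi>)\<close> is eventually nonincreasing.\<close>
lemma differential_inequality_imp_bigo_exp:
  fixes g g' :: "real \<Rightarrow> real"
  assumes der: "\<And>\<xi>. (g has_real_derivative g' \<xi>) (at \<xi>)"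
    and nonneg: "\<And>\<xi>. g \<xi> \<ge> 0"
    and ineq: "\<forall>\<^sub>F \<xi> in at_top. g' \<xi> \<le> - \<alpha> * g \<xi>"
  shows "g \<in> O[at_top](\<lambda>\<xi>. exp (- \<alpha> * \<xi>))"
proof -
  obtain p where p: "\<And>\<xi>. \<xi> \<ge> p \<Longrightarrow> g' \<xi> \<le> - \<alpha> * g \<xi>"
    using ineq by (auto simp: eventually_at_top_linorder)
  have dec: "g \<xi> * exp (\<alpha> * \<xi>) \<le> g p * exp (\<alpha> * p)" if "p \<le> \<xi>" for \<xi>
  proof (rule DERIV_nonpos_imp_nonincreasing[OF that])
    fix x assume "p \<le> x" "x \<le> \<xi>"
    have "((\<lambda>\<xi>. g \<xi> * exp (\<alpha> * \<xi>)) has_real_derivative (g' x + \<alpha> * g x) * exp (\<alpha> * x)) (at x)"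
      by (auto intro!: derivative_eq_intros der simp: algebra_simps)
    moreover have "(g' x + \<alpha> * g x) * exp (\<alpha> * x) \<le> 0"
      using p[OF \<open>p \<le> x\<close>] by (intro mult_nonpos_nonneg) auto
    ultimately show "\<exists>y. ((\<lambda>\<xi>. g \<xi> * exp (\<alpha> * \<xi>)) has_real_derivative y) (at x) \<and> y \<le> 0"
      by blast
  qed
  show ?thesis
  proof (rule bigoI)
    show "\<forall>\<^sub>F \<xi> in at_top. norm (g \<xi>) \<le> (g p * exp (\<alpha> * p)) * norm (exp (- \<alpha> * \<xi>))"
      using eventually_ge_at_top[of p]
    proof eventually_elim
      case (elim \<xi>)
      show ?case using dec[OF elim] nonneg[of \<xi>] by (simp add: exp_minus field_simps)
    qed
  qed
qed

text \<open>
  A reflection turns the behaviour at \<open>-\<infinity>\<close> into the same differential inequality at \<open>\<infinity>\<close>.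
\<close>
lemma two_sided_differential_inequality_imp_exponential_limit:
  fixes \<phi> \<psi> :: "real \<Rightarrow> real"
  assumes der: "\<And>\<xi>. (\<phi> has_real_derivative \<psi> \<xi>) (at \<xi>)"
    and ge: "\<And>\<xi>. k \<le> \<phi> \<xi>" and \<alpha>: "\<alpha> > 0"
    and ineq: "\<forall>\<^sub>F \<xi> in at_infinity. sgn \<xi> * \<psi> \<xi> \<le> - \<alpha> * (\<phi> \<xi> - k)"
  shows "tends_exponentially_at_infinity \<phi> k"
proof -
  have top: "\<forall>\<^sub>F \<xi> in at_top. sgn \<xi> * \<psi> \<xi> \<le> - \<alpha> * (\<phi> \<xi> - k)"
    and bot: "\<forall>\<^sub>F \<xi> in at_bot. sgn \<xi> * \<psi> \<xi> \<le> - \<alpha> * (\<phi> \<xi> - k)"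
    using ineq by (simp_all add: at_infinity_eq_at_top_bot eventually_sup)
  have "(\<lambda>\<xi>. \<phi> \<xi> - k) \<in> O[at_top](\<lambda>\<xi>. exp (- \<alpha> * \<xi>))"
  proof (rule differential_inequality_imp_bigo_exp[where g' = \<psi>])
    show "((\<lambda>\<xi>. \<phi> \<xi> - k) has_real_derivative \<psi> \<xi>) (at \<xi>)" for \<xi>
      using der[of \<xi>] by (auto intro!: derivative_eq_intros)
    show "\<forall>\<^sub>F \<xi> in at_top. \<psi> \<xi> \<le> - \<alpha> * (\<phi> \<xi> - k)"
      using top eventually_gt_at_top[of 0] by eventually_elim simp
  qed (use ge in auto)
  also have "(\<lambda>\<xi>. exp (- \<alpha> * \<xi>)) \<in> \<Theta>[at_top](\<lambda>\<xi>. exp (- \<alpha> * \<bar>\<xi>\<bar>))"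
    by (intro bigthetaI_cong eventually_mono[OF eventually_gt_at_top[of 0]]) auto
  finally have A: "(\<lambda>\<xi>. \<phi> \<xi> - k) \<in> O[at_top](\<lambda>\<xi>. exp (- \<alpha> * \<bar>\<xi>\<bar>))" .
  have "(\<lambda>\<xi>. \<phi> (-\<xi>) - k) \<in> O[at_top](\<lambda>\<xi>. exp (- \<alpha> * \<xi>))"
  proof (rule differential_inequality_imp_bigo_exp[where g' = "\<lambda>\<xi>. - \<psi> (-\<xi>)"])
    show "((\<lambda>\<xi>. \<phi> (-\<xi>) - k) has_real_derivative - \<psi> (-\<xi>)) (at \<xi>)" for \<xi>
      by (auto intro!: derivative_eq_intros DERIV_chain2[OF der])
    have "\<forall>\<^sub>F \<xi> in at_top. sgn (-\<xi>) * \<psi> (-\<xi>) \<le> - \<alpha> * (\<phi> (-\<xi>) - k)"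
      using bot by (simp add: at_bot_mirror eventually_filtermap)
    thus "\<forall>\<^sub>F \<xi> in at_top. - \<psi> (-\<xi>) \<le> - \<alpha> * (\<phi> (-\<xi>) - k)"
      using eventually_gt_at_top[of 0] by eventually_elim simp
  qed (use ge in auto)
  also have "(\<lambda>\<xi>. exp (- \<alpha> * \<xi>)) \<in> \<Theta>[at_top](\<lambda>\<xi>. exp (- \<alpha> * \<bar>-\<xi>\<bar>))"
    by (intro bigthetaI_cong eventually_mono[OF eventually_gt_at_top[of 0]]) auto
  finally have "(\<lambda>\<xi>. \<phi> \<xi> - k) \<in> O[at_bot](\<lambda>\<xi>. exp (- \<alpha> * \<bar>\<xi>\<bar>))"
    by (simp add: at_bot_mirror landau_o.big.in_filtermap_iff)
  with A show ?thesis
    unfolding tends_exponentially_at_infinity_def at_infinity_eq_at_top_bot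
    using \<alpha> by (auto intro: landau_o.big.sup)
qed

section \<open>Smoothness\<close>

inductive_set generated_algebra :: "(real \<Rightarrow> real) set \<Rightarrow> (real \<Rightarrow> real) set"
  for \<A> :: "(real \<Rightarrow> real) set" where
  gen: "f \<in> \<A> \<Longrightarrow> f \<in> generated_algebra \<A>"
| const: "(\<lambda>x. a) \<in> generated_algebra \<A>"
| add: "f \<in> generated_algebra \<A> \<Longrightarrow> g \<in> generated_algebra \<A> \<Longrightarrow>
        (\<lambda>x. f x + g x) \<in> generated_algebra \<A>"
| mult: "f \<in> generated_algebra \<A> \<Longrightarrow> g \<in> generated_algebra \<A> \<Longrightarrow>
        (\<lambda>x. f x * g x) \<in> generated_algebra \<A>"

text \<open>
  By the sum and product rules the whole generated algebra is closed under differentiation, so it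
  contains every iterated derivative of \<open>g\<close>.
\<close>
lemma smooth_if_generators_differentially_closed:
  assumes closed: "\<And>f. f \<in> \<A> \<Longrightarrow>
      \<exists>f' \<in> generated_algebra \<A>. \<forall>x. (f has_real_derivative f' x) (at x)"
    and g: "g \<in> \<A>"
  shows "smooth g"
proof -
  have step: "\<exists>f' \<in> generated_algebra \<A>. \<forall>x. (f has_real_derivative f' x) (at x)"
    if "f \<in> generated_algebra \<A>" for f
    using that
  proof induction
    case (gen f)
    thus ?case by (rule closed)
  next
    case (const a)
    show ?case by (rule bexI[OF _ generated_algebra.const[of 0]]) auto
  next
    case (add f g)
    then obtain f' g' where "f' \<in> generated_algebra \<A>" "g' \<in> generated_algebra \<A>"
      "\<forall>x. (f has_real_derivative f' x) (at x)" "\<forall>x. (g has_real_derivative g' x) (at x)" by blast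
    thus ?case
      by (intro bexI[of _ "\<lambda>x. f' x + g' x"]) (auto intro: DERIV_add generated_algebra.add)
  next
    case (mult f g)
    then obtain f' g' where *: "f' \<in> generated_algebra \<A>" "g' \<in> generated_algebra \<A>"
      "\<forall>x. (f has_real_derivative f' x) (at x)" "\<forall>x. (g has_real_derivative g' x) (at x)" by blast
    show ?case
      by (rule bexI[of _ "\<lambda>x. f' x * g x + g' x * f x"])
        (use * mult.hyps in \<open>auto intro!: DERIV_mult generated_algebra.add generated_algebra.mult\<close>)
  qed
  have iter: "(deriv ^^ n) g \<in> generated_algebra \<A>" for n
  proof (induction n)
    case 0
    show ?case using g by (simp add: generated_algebra.gen)
  next
    case (Suc n)
    then obtain f' where f': "f' \<in> generated_algebra \<A>"
      "\<forall>x. ((deriv ^^ n) g has_real_derivative f' x) (at x)" using step by blast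
    hence "deriv ((deriv ^^ n) g) = f'" by (auto intro: DERIV_imp_deriv)
    thus ?case using f' by simp
  qed
  show ?thesis
    unfolding smooth_def differentiable_on_def
    using step[OF iter]
    by (metis has_field_derivative_imp_has_derivative differentiable_at_withinI differentiable_def)
qed

section \<open>The travelling wave\<close>

text \<open>
  The travelling wave equation is the derivative of \<open>(c - \<phi>) \<phi>'' = (c - \<phi>) \<phi> - K\<close>.
\<close>
lemma CH_b1_solution_travelling_wave:
  fixes \<phi> \<psi> :: "real \<Rightarrow> real" and c K :: real
  assumes der\<phi>: "\<And>\<xi>. (\<phi> has_real_derivative \<psi> \<xi>) (at \<xi>)"
    and der\<psi>: "\<And>\<xi>. (\<psi> has_real_derivative \<phi> \<xi> - K / (c - \<phi> \<xi>)) (at \<xi>)"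
    and less: "\<And>\<xi>. \<phi> \<xi> < c"
  shows "CH_b1_solution (\<lambda>x t. \<phi> (x - c * t))"
proof -
  define f where "f \<xi> = \<phi> \<xi> - K / (c - \<phi> \<xi>)" for \<xi>
  define f' where "f' \<xi> = \<psi> \<xi> - K * \<psi> \<xi> / (c - \<phi> \<xi>)\<^sup>2" for \<xi>
  have neq: "c - \<phi> \<xi> \<noteq> 0" for \<xi> using less[of \<xi>] by simp
  have derf: "(f has_real_derivative f' \<xi>) (at \<xi>)" for \<xi>
    unfolding f_def f'_def
    by (rule derivative_eq_intros der\<phi> refl neq)+ (simp add: power2_eq_square)
  have x: "((\<lambda>y. g (y - c * t)) has_real_derivative g' (x - c * t)) (at x)"
    if "\<And>\<xi>. (g has_real_derivative g' \<xi>) (at \<xi>)" for g g' x t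
    by (rule DERIV_chain2[OF that, THEN DERIV_cong]) (auto intro!: derivative_eq_intros)
  have t: "((\<lambda>s. g (x - c * s)) has_real_derivative - c * g' (x - c * t)) (at t)"
    if "\<And>\<xi>. (g has_real_derivative g' \<xi>) (at \<xi>)" for g g' x t
    by (rule DERIV_chain2[OF that, THEN DERIV_cong]) (auto intro!: derivative_eq_intros)
  note der\<psi>' = der\<psi>[folded f_def]
  let ?u = "\<lambda>x t. \<phi> (x - c * t)"
  have Dx: "D_x ?u = (\<lambda>x t. \<psi> (x - c * t))" "D_x (\<lambda>x t. \<psi> (x - c * t)) = (\<lambda>x t. f (x - c * t))"
    "D_x (\<lambda>x t. f (x - c * t)) = (\<lambda>x t. f' (x - c * t))"
    unfolding D_x_def by (intro ext DERIV_imp_deriv x der\<phi> der\<psi>' derf)+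
  have Dt: "D_t ?u = (\<lambda>x t. - c * \<psi> (x - c * t))"
    unfolding D_t_def by (intro ext DERIV_imp_deriv t der\<phi>)
  have xc: "((\<lambda>y. - c * g (y - c * t)) has_real_derivative - c * g' (x - c * t)) (at x)"
    if "\<And>\<xi>. (g has_real_derivative g' \<xi>) (at \<xi>)" for g g' x t
    by (intro DERIV_cmult x that)
  have Dxt: "D_x (\<lambda>x t. - c * \<psi> (x - c * t)) = (\<lambda>x t. - c * f (x - c * t))"
    "D_x (\<lambda>x t. - c * f (x - c * t)) = (\<lambda>x t. - c * f' (x - c * t))"
    unfolding D_x_def by (intro ext DERIV_imp_deriv xc der\<psi>' derf)+
  have ode: "- c * \<psi> \<xi> - - c * f' \<xi> + 2 * \<phi> \<xi> * \<psi> \<xi> = \<psi> \<xi> * f \<xi> + \<phi> \<xi> * f' \<xi>" for \<xi>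
  proof -
    have "(c - \<phi> \<xi>) * f' \<xi> = (c - \<phi> \<xi>) * \<psi> \<xi> - K * \<psi> \<xi> / (c - \<phi> \<xi>)"
      using neq[of \<xi>] unfolding f'_def by (simp add: right_diff_distrib) (simp add: power2_eq_square)
    moreover have "\<psi> \<xi> * f \<xi> = \<phi> \<xi> * \<psi> \<xi> - K * \<psi> \<xi> / (c - \<phi> \<xi>)"
      unfolding f_def by (simp add: algebra_simps)
    ultimately show ?thesis by (simp add: algebra_simps)
  qed
  have diffx: "(\<lambda>y. g (y - c * t)) differentiable (at x)"
    "(\<lambda>y. - c * g (y - c * t)) differentiable (at x)"
    "(\<lambda>s. g (x - c * s)) differentiable (at t)"
    if "\<And>\<xi>. (g has_real_derivative g' \<xi>) (at \<xi>)" for g g' x t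
    using x[OF that] xc[OF that] t[OF that] real_differentiable_def by blast+
  show ?thesis
    unfolding CH_b1_solution_def Dx Dt Dxt has_D_x_def has_D_t_def
    using diffx[OF der\<phi>] diffx[OF der\<psi>'] diffx[OF derf] ode by blast
qed

text \<open>
  The reciprocal \<open>1 / (c - \<phi>)\<close> is adjoined to the generators \<open>\<phi>\<close>, \<open>\<phi>'\<close>; the three of them are closed
  under differentiation up to polynomial operations.
\<close>
lemma smooth_travelling_wave:
  fixes \<phi> \<psi> :: "real \<Rightarrow> real" and c K :: real
  assumes der\<phi>: "\<And>\<xi>. (\<phi> has_real_derivative \<psi> \<xi>) (at \<xi>)"
    and der\<psi>: "\<And>\<xi>. (\<psi> has_real_derivative \<phi> \<xi> - K / (c - \<phi> \<xi>)) (at \<xi>)"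
    and less: "\<And>\<xi>. \<phi> \<xi> < c"
  shows "smooth \<phi>"
proof -
  define r where "r \<xi> = 1 / (c - \<phi> \<xi>)" for \<xi>
  define \<A> where "\<A> = {\<phi>, \<psi>, r}"
  have neq: "c - \<phi> \<xi> \<noteq> 0" for \<xi> using less[of \<xi>] by simp
  have derr: "(r has_real_derivative \<psi> \<xi> * (r \<xi> * r \<xi>)) (at \<xi>)" for \<xi>
    unfolding r_def by (rule derivative_eq_intros der\<phi> refl neq)+ simp
  have der\<psi>': "(\<psi> has_real_derivative \<phi> \<xi> + (- K) * r \<xi>) (at \<xi>)" for \<xi>
    using der\<psi>[of \<xi>] by (simp add: r_def)
  have gens: "\<phi> \<in> generated_algebra \<A>" "\<psi> \<in> generated_algebra \<A>" "r \<in> generated_algebra \<A>"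
    by (auto intro: generated_algebra.gen simp: \<A>_def)
  show ?thesis
  proof (rule smooth_if_generators_differentially_closed)
    fix f assume "f \<in> \<A>"
    then consider "f = \<phi>" | "f = \<psi>" | "f = r" by (auto simp: \<A>_def)
    thus "\<exists>f' \<in> generated_algebra \<A>. \<forall>x. (f has_real_derivative f' x) (at x)"
    proof cases
      case 1
      thus ?thesis using der\<phi> gens by blast
    next
      case 2
      have "(\<lambda>\<xi>. \<phi> \<xi> + (- K) * r \<xi>) \<in> generated_algebra \<A>"
        by (intro generated_algebra.add generated_algebra.mult generated_algebra.const gens)
      thus ?thesis unfolding 2 using der\<psi>' by (intro bexI[of _ "\<lambda>\<xi>. \<phi> \<xi> + (- K) * r \<xi>"]) auto
    next
      case 3
      have "(\<lambda>\<xi>. \<psi> \<xi> * (r \<xi> * r \<xi>)) \<in> generated_algebra \<A>"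
        by (intro generated_algebra.mult gens)
      thus ?thesis using 3 derr by (intro bexI[of _ "\<lambda>\<xi>. \<psi> \<xi> * (r \<xi> * r \<xi>)"]) auto
    qed
  qed (simp add: \<A>_def)
qed

theorem theorem3p1:
  fixes c \<kappa> :: real
  assumes "c > 0" and "0 < \<kappa>" and "\<kappa> < c / 2"
  shows "\<exists>\<phi> :: real \<Rightarrow> real.
           smooth \<phi> \<and>
           CH_b1_solution (\<lambda>x t. \<phi> (x - c * t)) \<and>
           tends_exponentially_at_infinity \<phi> \<kappa> \<and>
           deriv \<phi> 0 = 0 \<and>
           (\<forall>\<xi>. \<kappa> < \<phi> \<xi> \<and> \<phi> \<xi> < c)"
proof -
  define K where "K = \<kappa> * (c - \<kappa>)"
  define f where "f y = y - K / (c - y)" for y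
  define F where "F y = y\<^sup>2 - \<kappa>\<^sup>2 + 2 * K * ln ((c - y) / (c - \<kappa>))" for y
  have K: "K > 0" and ck: "\<kappa> < c - \<kappa>" "c - \<kappa> < c" using assms by (auto simp: K_def)
  have derF: "(F has_real_derivative 2 * f y) (at y)" if "y < c" for y
  proof -
    have quot: "(c - y) / (c - \<kappa>) > 0" using that ck assms by simp
    have "((\<lambda>y. (c - y) / (c - \<kappa>)) has_real_derivative - 1 / (c - \<kappa>)) (at y)"
      by (intro DERIV_cdivide) (auto intro!: derivative_eq_intros)
    from DERIV_chain2[OF DERIV_ln[OF quot] this]
    have "((\<lambda>y. ln ((c - y) / (c - \<kappa>))) has_real_derivative - (1 / (c - y))) (at y)"
      using that ck assms by simp
    hence "((\<lambda>y. 2 * K * ln ((c - y) / (c - \<kappa>))) has_real_derivative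
        2 * K * - (1 / (c - y))) (at y)"
      by (rule DERIV_cmult)
    moreover have "((\<lambda>y. y\<^sup>2 - \<kappa>\<^sup>2) has_real_derivative 2 * y) (at y)"
      by (auto intro!: derivative_eq_intros)
    ultimately show ?thesis
      using DERIV_add[THEN DERIV_cong] unfolding F_def f_def
      by (fastforce simp: right_diff_distrib)
  qed
  have contF: "continuous_on {x..y} F" if "y < c" for x y
    using that by (intro continuous_at_imp_continuous_on ballI DERIV_isCont[OF derF]) auto
  have F\<kappa>: "F \<kappa> = 0" using ck by (simp add: F_def)
  have f_eq: "f y = (y - \<kappa>) * ((c - \<kappa> - y) / (c - y))" if "y < c" for y
    using that by (simp add: f_def K_def divide_simps) (simp add: algebra_simps)
  have f_le: "f y \<le> y - \<kappa>" if "\<kappa> \<le> y" "y < c" for y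
  proof -
    have "(c - \<kappa> - y) / (c - y) \<le> 1" using that assms by simp
    from mult_left_mono[OF this, of "y - \<kappa>"] show ?thesis using that by (simp add: f_eq)
  qed
  \<comment> \<open>\<open>\<alpha>\<^sup>2\<close> is a lower bound for \<open>f y / (y - \<kappa>)\<close> as long as \<open>y\<close> stays below \<open>c / 2\<close>.\<close>
  define \<alpha> where "\<alpha> = sqrt ((c / 2 - \<kappa>) / c)"
  have \<alpha>: "\<alpha> > 0" "\<alpha>\<^sup>2 = (c / 2 - \<kappa>) / c" using assms by (auto simp: \<alpha>_def)
  have f_ge: "\<alpha>\<^sup>2 * (y - \<kappa>) \<le> f y" if "\<kappa> \<le> y" "y \<le> c / 2" for y
  proof -
    have "(c / 2 - \<kappa>) / c \<le> (c - \<kappa> - y) / (c - y)"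
      using that assms by (intro frac_le) auto
    from mult_left_mono[OF this, of "y - \<kappa>"] show ?thesis
      using that assms by (simp add: f_eq \<alpha> mult.commute)
  qed
  have F_le: "F y \<le> (y - \<kappa>)\<^sup>2" if "\<kappa> \<le> y" "y < c" for y
  proof -
    have "(\<kappa> - \<kappa>)\<^sup>2 - F \<kappa> \<le> (y - \<kappa>)\<^sup>2 - F y"
    proof (rule DERIV_nonneg_imp_nondecreasing[OF that(1)])
      fix x assume x: "\<kappa> \<le> x" "x \<le> y"
      have "((\<lambda>y. (y - \<kappa>)\<^sup>2 - F y) has_real_derivative 2 * (x - \<kappa>) - 2 * f x) (at x)"
        using x that by (auto intro!: derivative_eq_intros derF)
      thus "\<exists>z. ((\<lambda>y. (y - \<kappa>)\<^sup>2 - F y) has_real_derivative z) (at x) \<and> 0 \<le> z"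
        using f_le[of x] x that by (intro exI conjI) auto
    qed
    thus ?thesis by (simp add: F\<kappa>)
  qed
  have F_ge: "(\<alpha> * (y - \<kappa>))\<^sup>2 \<le> F y" if "\<kappa> \<le> y" "y \<le> c / 2" for y
  proof -
    have "F \<kappa> - (\<alpha> * (\<kappa> - \<kappa>))\<^sup>2 \<le> F y - (\<alpha> * (y - \<kappa>))\<^sup>2"
    proof (rule DERIV_nonneg_imp_nondecreasing[OF that(1)])
      fix x assume x: "\<kappa> \<le> x" "x \<le> y"
      have "((\<lambda>y. F y - (\<alpha> * (y - \<kappa>))\<^sup>2) has_real_derivative 2 * f x - 2 * (\<alpha>\<^sup>2 * (x - \<kappa>))) (at x)"
        using x that assms
        by (auto intro!: derivative_eq_intros derF simp: power2_eq_square algebra_simps)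
      thus "\<exists>z. ((\<lambda>y. F y - (\<alpha> * (y - \<kappa>))\<^sup>2) has_real_derivative z) (at x) \<and> 0 \<le> z"
        using f_ge[of x] x that by (intro exI conjI) auto
    qed
    thus ?thesis by (simp add: F\<kappa>)
  qed
  have F_pos: "F y > 0" if "\<kappa> < y" "y \<le> c - \<kappa>" for y
  proof -
    have "F \<kappa> < F y"
    proof (rule DERIV_pos_imp_increasing_open[OF that(1)])
      fix x assume x: "\<kappa> < x" "x < y"
      hence "f x > 0" using that ck by (simp add: f_eq)
      thus "\<exists>z. (F has_real_derivative z) (at x) \<and> 0 < z"
        using derF[of x] x that ck by (intro exI[of _ "2 * f x"] conjI) auto
    next
      show "continuous_on {\<kappa>..y} F"
        by (rule contF) (use that ck in auto)
    qed
    thus ?thesis by (simp add: F\<kappa>)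
  qed
  have F_dec: "F z < F y" if "c - \<kappa> \<le> y" "y < z" "z < c" for y z
  proof (rule DERIV_neg_imp_decreasing_open[OF that(2)])
    fix x assume x: "y < x" "x < z"
    hence "f x < 0" using that ck assms by (simp add: f_eq mult_pos_neg divide_neg_pos)
    thus "\<exists>z. (F has_real_derivative z) (at x) \<and> z < 0"
      using derF[of x] x that ck by (intro exI[of _ "2 * f x"] conjI) auto
  next
    show "continuous_on {y..z} F"
      by (rule contF) (use that ck in auto)
  qed
  \<comment> \<open>The logarithm beats the quadratic term, which stays below \<open>c\<^sup>2\<close>: \<open>y1\<close> is the
    solution of \<open>2 * K * ln ((c - y) / (c - \<kappa>)) = - c\<^sup>2\<close>.\<close>
  define e where "e = exp (- c\<^sup>2 / (2 * K))"
  define y1 where "y1 = c - (c - \<kappa>) * e"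
  have e: "0 < e" "e < 1" using K assms by (simp_all add: e_def divide_less_0_iff)
  have y1: "\<kappa> < y1" "y1 < c"
    using mult_strict_left_mono[OF e(2), of "c - \<kappa>"] mult_pos_pos[OF _ e(1), of "c - \<kappa>"] ck assms
    unfolding y1_def by (simp_all add: algebra_simps)
  have "F y1 = y1\<^sup>2 - \<kappa>\<^sup>2 - c\<^sup>2" using ck K assms by (simp add: F_def y1_def e_def)
  moreover have "y1\<^sup>2 < c\<^sup>2" using y1 assms by (intro power_strict_mono) auto
  ultimately have Fy1: "F y1 < 0" using zero_le_power2[of \<kappa>] by linarith
  hence "c - \<kappa> < y1" using F_pos[of y1] y1 by force
  moreover have "continuous_on {c - \<kappa>..y1} F"
    by (rule contF[OF y1(2)])
  ultimately obtain M where M: "c - \<kappa> \<le> M" "M \<le> y1" "F M = 0"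
    using IVT2'[of F y1 0 "c - \<kappa>"] Fy1 F_pos[of "c - \<kappa>"] ck by auto
  have M': "c - \<kappa> < M" "M < c" "\<kappa> < M"
    using M F_pos[of "c - \<kappa>"] ck y1 by (force simp: order_le_less)+
  obtain \<phi> \<psi> where der\<phi>: "\<And>\<xi>. (\<phi> has_real_derivative \<psi> \<xi>) (at \<xi>)"
    and der\<psi>: "\<And>\<xi>. (\<psi> has_real_derivative f (\<phi> \<xi>)) (at \<xi>)"
    and \<phi>: "\<And>\<xi>. \<kappa> < \<phi> \<xi>" "\<And>\<xi>. \<phi> \<xi> \<le> M"
    and \<psi>: "\<And>\<xi>. \<psi> \<xi> = - sgn \<xi> * sqrt (F (\<phi> \<xi>))"
    and lim: "(\<phi> \<longlongrightarrow> \<kappa>) at_infinity"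
  proof (rule homoclinic_orbit[of \<kappa> M 1 F f])
    show "continuous_on {\<kappa><..M} f"
      unfolding f_def using M' by (intro continuous_intros) auto
    show "F y > 0" if "\<kappa> < y" "y < M" for y
      using that F_pos[of y] F_dec[of y M] M M' by (cases "y \<le> c - \<kappa>") auto
    show "f M < 0" using M' by (simp add: f_eq mult_pos_neg divide_neg_pos)
  qed (use M M' derF F_le in auto)
  have less: "\<phi> \<xi> < c" for \<xi> using \<phi>(2)[of \<xi>] M' by simp
  have "tends_exponentially_at_infinity \<phi> \<kappa>"
  proof (rule two_sided_differential_inequality_imp_exponential_limit[OF der\<phi> _ \<alpha>(1)])
    have "\<forall>\<^sub>F \<xi> in at_infinity. \<phi> \<xi> < c / 2" using order_tendstoD(2)[OF lim assms(3)] .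
    moreover have "\<forall>\<^sub>F \<xi>::real in at_infinity. \<xi> \<noteq> 0"
      by (auto simp: eventually_at_infinity intro!: exI[of _ 1])
    ultimately show "\<forall>\<^sub>F \<xi> in at_infinity. sgn \<xi> * \<psi> \<xi> \<le> - \<alpha> * (\<phi> \<xi> - \<kappa>)"
    proof eventually_elim
      case (elim \<xi>)
      have "\<alpha> * (\<phi> \<xi> - \<kappa>) \<le> sqrt (F (\<phi> \<xi>))"
        using F_ge[of "\<phi> \<xi>"] \<phi>(1)[of \<xi>] elim by (intro real_le_rsqrt) auto
      moreover have "sgn \<xi> * \<psi> \<xi> = - sqrt (F (\<phi> \<xi>))"
        using elim by (auto simp: \<psi> sgn_if)
      ultimately show ?case by simp
    qed
  qed (use \<phi>(1) less_imp_le in blast)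
  moreover have "deriv \<phi> 0 = 0" using DERIV_imp_deriv[OF der\<phi>[of 0]] \<psi>[of 0] by simp
  ultimately show ?thesis
    using smooth_travelling_wave[OF der\<phi> der\<psi>[unfolded f_def] less]
      CH_b1_solution_travelling_wave[OF der\<phi> der\<psi>[unfolded f_def] less] \<phi>(1) less
    by blast
qed

end
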